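(* Let $(\Omega,\mathcal B)$ be a standard Borel space endowed with a nonatomic probability measure $\mathbb P$, let $\mathsf X,\mathsf Y$ be separable Banach spaces, $p,q\in[1,+\infty)$, $\mathcal X:=L^p(\Omega,\mathcal B,\mathbb P;\mathsf X)$, $\mathcal Y:=L^q(\Omega,\mathcal B,\mathbb P;\mathsf Y)$. If $B\subset\mathcal X\times\mathcal Y$ is invariant by measure-preserving isomorphisms, then its closure $\overline B$ is also law invariant. In particular, a closed set of $\mathcal X\times\mathcal Y$ is law invariant if and only if it is invariant by measure-preserving isomorphisms, and if $\boldsymbol L:\mathrm D(\boldsymbol L)\subset\mathcal X\to\mathcal Y$ is a continuous operator invariant by measure-preserving isomorphisms and $\mathrm D(\boldsymbol L)$ is closed, then $\boldsymbol L$ is also law invariant.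
   Context: $\mathrm S(\Omega)$ is the class of $\mathcal B$-$\mathcal B$-measurable maps $g:\Omega\to\Omega$ that are essentially injective (injective on some $\Omega_0\in\mathcal B$ with $\mathbb P(\Omega_0)=1$) and measure-preserving ($g_\sharp\mathbb P=\mathbb P$). A set $B\subset\mathcal X\times\mathcal Y$ is invariant by measure-preserving isomorphisms if $(X,Y)\in B$, $g\in\mathrm S(\Omega)$ imply $(X\circ g,Y\circ g)\in B$. It is law invariant if $(X,Y)\in B$, $(X',Y')\in\mathcal X\times\mathcal Y$ and $(X,Y)_\sharp\mathbb P=(X',Y')_\sharp\mathbb P$ imply $(X',Y')\in B$. A single-valued operator $\boldsymbol L:\mathrm D(\boldsymbol L)\subset\mathcal X\to\mathcal Y$ has either property if its graph in $\mathcal X\times\mathcal Y$ does. Closures are in the (strong) product topology. *)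

theory Defs
  imports "HOL-Probability.Probability"
begin

section \<open>The probability space\<close>

definition standard_borel :: "'a measure \<Rightarrow> bool" where
  "standard_borel M \<longleftrightarrow>
     (\<exists>T. completely_metrizable_space T \<and> separable_space T \<and> topspace T = space M \<and>
          sets M = sigma_sets (space M) {U. openin T U})"

definition nonatomic :: "'a measure \<Rightarrow> bool" where
  "nonatomic M \<longleftrightarrow>
     (\<forall>A\<in>sets M. 0 < emeasure M A \<longrightarrow>
        (\<exists>A'\<in>sets M. A' \<subseteq> A \<and> 0 < emeasure M A' \<and> emeasure M A' < emeasure M A))"

definition mp_isos :: "'a measure \<Rightarrow> ('a \<Rightarrow> 'a) set" where
  "mp_isos M =
     {g \<in> measurable M M.
        (\<exists>A\<in>sets M. emeasure M A = 1 \<and> inj_on g A) \<and> distr M M g = M}"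

section \<open>Bochner--Lebesgue spaces\<close>

text \<open>
  Elements of \<open>Lp_space M p\<close> are classes of functions modulo equality almost everywhere.
  For a separable Banach space as codomain, Borel and strong measurability coincide.
\<close>

definition Lp_fun :: "'a measure \<Rightarrow> real \<Rightarrow> ('a \<Rightarrow> 'x::{banach, second_countable_topology}) set" where
  "Lp_fun M p = {f \<in> borel_measurable M. integrable M (\<lambda>w. norm (f w) powr p)}"

definition ae_class :: "'a measure \<Rightarrow> ('a \<Rightarrow> 'x::{banach, second_countable_topology}) \<Rightarrow> ('a \<Rightarrow> 'x) set" where
  "ae_class M f = {g \<in> borel_measurable M. AE w in M. g w = f w}"

definition Lp_space :: "'a measure \<Rightarrow> real \<Rightarrow> ('a \<Rightarrow> 'x::{banach, second_countable_topology}) set set" where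
  "Lp_space M p = ae_class M ` Lp_fun M p"

definition Lp_norm :: "'a measure \<Rightarrow> real \<Rightarrow> ('a \<Rightarrow> 'x::{banach, second_countable_topology}) \<Rightarrow> real" where
  "Lp_norm M p f = (\<integral>w. norm (f w) powr p \<partial>M) powr (1 / p)"

text \<open>The choice of representatives is immaterial, see \<open>Lp_dist_ae_class\<close> below.\<close>

definition Lp_dist ::
    "'a measure \<Rightarrow> real \<Rightarrow> ('a \<Rightarrow> 'x::{banach, second_countable_topology}) set \<Rightarrow> ('a \<Rightarrow> 'x) set \<Rightarrow> real" where
  "Lp_dist M p F G = Lp_norm M p (\<lambda>w. (SOME f. f \<in> F) w - (SOME g. g \<in> G) w)"

definition Lp_topology ::
    "'a measure \<Rightarrow> real \<Rightarrow> ('a \<Rightarrow> 'x::{banach, second_countable_topology}) set topology" where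
  "Lp_topology M p = Metric_space.mtopology (Lp_space M p) (Lp_dist M p)"

lemma ae_class_self: "f \<in> borel_measurable M \<Longrightarrow> f \<in> ae_class M f"
  by (simp add: ae_class_def)

lemma Lp_fun_measurable: "f \<in> Lp_fun M p \<Longrightarrow> f \<in> borel_measurable M"
  by (simp add: Lp_fun_def)

lemma ae_class_eq_iff:
  assumes "f \<in> borel_measurable M" "g \<in> borel_measurable M"
  shows "ae_class M f = ae_class M g \<longleftrightarrow> (AE w in M. f w = g w)"
proof
  assume "ae_class M f = ae_class M g"
  then show "AE w in M. f w = g w"
    using ae_class_self[OF assms(1)] by (auto simp: ae_class_def)
next
  assume fg: "AE w in M. f w = g w"
  have "(AE w in M. h w = f w) \<longleftrightarrow> (AE w in M. h w = g w)" for h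
    proof
    assume "AE w in M. h w = f w"
    then show "AE w in M. h w = g w" using fg by eventually_elim simp
  next
    assume "AE w in M. h w = g w"
    then show "AE w in M. h w = f w" using fg by eventually_elim simp
  qed
  then show "ae_class M f = ae_class M g"
    by (simp add: ae_class_def)
qed

lemma Lp_norm_cong_AE:
  assumes "f \<in> borel_measurable M" "g \<in> borel_measurable M" "AE w in M. f w = g w"
  shows "Lp_norm M p f = Lp_norm M p g"
proof -
  have "(\<integral>w. norm (f w) powr p \<partial>M) = (\<integral>w. norm (g w) powr p \<partial>M)"
    using assms by (intro integral_cong_AE) auto
  then show ?thesis by (simp add: Lp_norm_def)
qed

lemma Lp_dist_ae_class:
  assumes "f \<in> borel_measurable M" "g \<in> borel_measurable M"
  shows "Lp_dist M p (ae_class M f) (ae_class M g) = Lp_norm M p (\<lambda>w. f w - g w)"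
proof -
  define f' g' where "f' = (SOME h. h \<in> ae_class M f)" and "g' = (SOME h. h \<in> ae_class M g)"
  have f': "f' \<in> ae_class M f"
    unfolding f'_def some_in_eq using ae_class_self[OF assms(1)] by auto
  have g': "g' \<in> ae_class M g"
    unfolding g'_def some_in_eq using ae_class_self[OF assms(2)] by auto
  have [measurable]: "f' \<in> borel_measurable M" "g' \<in> borel_measurable M"
    and ae: "AE w in M. f' w = f w" "AE w in M. g' w = g w"
    using f' g' by (auto simp: ae_class_def)
  note assms[measurable]
  have "Lp_norm M p (\<lambda>w. f' w - g' w) = Lp_norm M p (\<lambda>w. f w - g w)"
  proof (rule Lp_norm_cong_AE)
    show "AE w in M. f' w - g' w = f w - g w"
      using ae by eventually_elim simp
  qed measurable
  then show ?thesis by (simp add: Lp_dist_def f'_def g'_def)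
qed

lemma convex_on_powr_nonneg:
  fixes p :: real
  assumes p: "1 \<le> p"
  shows "convex_on {0..} (\<lambda>x. x powr p)"
proof (rule convex_onI)
  fix t x y :: real
  assume t: "0 < t" "t < 1" and xy: "x \<in> {0..}" "y \<in> {0..}"
  have small: "(s * z) powr p \<le> s * z powr p" if "0 < s" "s < 1" "0 \<le> z" for s z :: real
  proof -
    have "s powr p \<le> s powr 1" using that p by (intro powr_mono') auto
    then show ?thesis using that by (simp add: powr_mult mult_right_mono)
  qed
  show "((1 - t) *\<^sub>R x + t *\<^sub>R y) powr p \<le> (1 - t) * x powr p + t * y powr p"
  proof (cases "0 < x \<and> 0 < y")
    case True
    then show ?thesis using convex_onD[OF powr_convex[OF p], of t x y] t by simp
  next
    case False
    then have "x = 0 \<or> y = 0" using xy by auto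
    then show ?thesis using small[of t y] small[of "1 - t" x] t xy p by auto
  qed
qed simp

lemma convex_powr_le:
  fixes a b x y :: real
  assumes "1 \<le> p" "0 < a" "0 < b" "0 \<le> x" "0 \<le> y"
  shows "(x + y) powr p \<le> (a + b) powr p *
           (a / (a + b) * (x powr p / a powr p) + b / (a + b) * (y powr p / b powr p))"
proof -
  define t where "t = b / (a + b)"
  have t: "0 \<le> t" "t \<le> 1" "1 - t = a / (a + b)"
    using assms by (auto simp: t_def field_simps)
  have "((1 - t) *\<^sub>R (x / a) + t *\<^sub>R (y / b)) powr p
          \<le> (1 - t) * (x / a) powr p + t * (y / b) powr p"
    by (rule convex_onD[OF convex_on_powr_nonneg[OF assms(1)]]) (use t assms in auto)
  moreover have "(1 - t) *\<^sub>R (x / a) + t *\<^sub>R (y / b) = (x + y) / (a + b)"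
    unfolding t(3) using assms by (simp add: t_def add_divide_distrib)
  ultimately have "((x + y) / (a + b)) powr p
      \<le> a / (a + b) * (x powr p / a powr p) + b / (a + b) * (y powr p / b powr p)"
    unfolding t(3) using assms by (simp add: t_def powr_divide)
  moreover have "((x + y) / (a + b)) powr p = (x + y) powr p / (a + b) powr p"
    using assms by (simp add: powr_divide)
  ultimately show ?thesis
    using assms by (simp add: divide_le_eq mult.commute)
qed

lemma Minkowski:
  assumes p: "1 \<le> p" and f: "f \<in> Lp_fun M p" and g: "g \<in> Lp_fun M p"
  shows "(\<lambda>w. f w + g w) \<in> Lp_fun M p"
    and "Lp_norm M p (\<lambda>w. f w + g w) \<le> Lp_norm M p f + Lp_norm M p g"
proof -
  have [measurable]: "f \<in> borel_measurable M" "g \<in> borel_measurable M"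
    and i: "integrable M (\<lambda>w. norm (f w) powr p)" "integrable M (\<lambda>w. norm (g w) powr p)"
    using f g by (auto simp: Lp_fun_def)
  let ?h = "\<lambda>a b w. (a + b) powr p * (a / (a + b) * (norm (f w) powr p / a powr p)
              + b / (a + b) * (norm (g w) powr p / b powr p))"
  have le: "norm (f w + g w) powr p \<le> ?h a b w" if "0 < a" "0 < b" for a b w
  proof -
    have "norm (f w + g w) powr p \<le> (norm (f w) + norm (g w)) powr p"
      using p by (intro powr_mono2 norm_triangle_ineq) auto
    also have "\<dots> \<le> ?h a b w"
      using p that by (intro convex_powr_le) auto
    finally show ?thesis .
  qed
  have ih: "integrable M (?h a b)" for a b
    using i by (intro integrable_mult_right Bochner_Integration.integrable_add
        integrable_divide) auto
  have ifg: "integrable M (\<lambda>w. norm (f w + g w) powr p)"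
  proof (rule Bochner_Integration.integrable_bound[OF ih[of 1 1]])
    show "AE w in M. norm (norm (f w + g w) powr p) \<le> norm (?h 1 1 w)"
    proof (rule AE_I2)
      fix w
      have "norm (f w + g w) powr p \<le> ?h 1 1 w" by (rule le) auto
      then show "norm (norm (f w + g w) powr p) \<le> norm (?h 1 1 w)"
        unfolding real_norm_def by (smt (verit) powr_ge_zero)
    qed
  qed measurable
  then show "(\<lambda>w. f w + g w) \<in> Lp_fun M p"
    by (simp add: Lp_fun_def)
  have int_le: "(\<integral>w. norm (u w) powr p \<partial>M) \<le> a powr p"
    if "Lp_norm M p u < a" for u :: "'a \<Rightarrow> 'b" and a
  proof -
    have "(\<integral>w. norm (u w) powr p \<partial>M) = Lp_norm M p u powr p"
      using p by (simp add: Lp_norm_def powr_powr)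
    also have "\<dots> \<le> a powr p"
      using that p by (intro powr_mono2) (auto simp: Lp_norm_def)
    finally show ?thesis .
  qed
  show "Lp_norm M p (\<lambda>w. f w + g w) \<le> Lp_norm M p f + Lp_norm M p g"
  proof (rule field_le_epsilon)
    fix e :: real assume e: "0 < e"
    define a b where "a = Lp_norm M p f + e / 2" and "b = Lp_norm M p g + e / 2"
    have nn: "0 \<le> Lp_norm M p f" "0 \<le> Lp_norm M p g" by (auto simp: Lp_norm_def)
    have ab: "0 < a" "0 < b" "Lp_norm M p f < a" "Lp_norm M p g < b"
      using nn e by (auto simp: a_def b_def)
    have "(\<integral>w. norm (f w + g w) powr p \<partial>M) \<le> (\<integral>w. ?h a b w \<partial>M)"
      by (rule integral_mono[OF ifg ih]) (use le ab in auto)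
    also have "\<dots> = (a + b) powr p * (a / (a + b) * ((\<integral>w. norm (f w) powr p \<partial>M) / a powr p)
              + b / (a + b) * ((\<integral>w. norm (g w) powr p \<partial>M) / b powr p))"
      using i by simp
    also have "\<dots> \<le> (a + b) powr p * (a / (a + b) * 1 + b / (a + b) * 1)"
      using ab int_le[OF ab(3)] int_le[OF ab(4)]
      by (intro mult_left_mono add_mono) (auto simp: divide_le_eq)
    also have "\<dots> = (a + b) powr p"
      using ab by (simp add: add_divide_distrib[symmetric])
    finally have "Lp_norm M p (\<lambda>w. f w + g w) \<le> ((a + b) powr p) powr (1 / p)"
      unfolding Lp_norm_def using p by (intro powr_mono2) auto
    also have "\<dots> = a + b"
      using ab p by (simp add: powr_powr)
    finally show "Lp_norm M p (\<lambda>w. f w + g w) \<le> Lp_norm M p f + Lp_norm M p g + e"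
      by (simp add: a_def b_def)
  qed
qed

lemma Lp_fun_diff:
  assumes "1 \<le> p" "f \<in> Lp_fun M p" "g \<in> Lp_fun M p"
  shows "(\<lambda>w. f w - g w) \<in> Lp_fun M p"
proof -
  have "(\<lambda>w. - g w) \<in> Lp_fun M p"
    using assms(3) by (simp add: Lp_fun_def)
  from Minkowski(1)[OF assms(1,2) this] show ?thesis by simp
qed

lemma Metric_space_Lp:
  assumes p: "1 \<le> p"
  shows "Metric_space (Lp_space M p) (Lp_dist M p)"
proof
  fix F G :: "('a \<Rightarrow> 'b) set"
  show "0 \<le> Lp_dist M p F G" by (simp add: Lp_dist_def Lp_norm_def)
  show "Lp_dist M p F G = Lp_dist M p G F"
    by (simp add: Lp_dist_def Lp_norm_def norm_minus_commute)
next
  fix F G :: "('a \<Rightarrow> 'b) set"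
  assume "F \<in> Lp_space M p" "G \<in> Lp_space M p"
  then obtain f g where fg: "f \<in> Lp_fun M p" "g \<in> Lp_fun M p"
    and FG: "F = ae_class M f" "G = ae_class M g"
    by (auto simp: Lp_space_def)
  note [measurable] = fg[THEN Lp_fun_measurable]
  have "Lp_dist M p F G = 0 \<longleftrightarrow> (\<integral>w. norm (f w - g w) powr p \<partial>M) = 0"
    by (simp add: FG Lp_dist_ae_class Lp_norm_def)
  also have "\<dots> \<longleftrightarrow> (AE w in M. norm (f w - g w) powr p = 0)"
    using Lp_fun_diff[OF p fg] by (intro integral_nonneg_eq_0_iff_AE) (auto simp: Lp_fun_def)
  also have "\<dots> \<longleftrightarrow> F = G"
    by (simp add: FG ae_class_eq_iff)
  finally show "Lp_dist M p F G = 0 \<longleftrightarrow> F = G" .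
next
  fix F G H :: "('a \<Rightarrow> 'b) set"
  assume "F \<in> Lp_space M p" "G \<in> Lp_space M p" "H \<in> Lp_space M p"
  then obtain f g h where fgh: "f \<in> Lp_fun M p" "g \<in> Lp_fun M p" "h \<in> Lp_fun M p"
    and FGH: "F = ae_class M f" "G = ae_class M g" "H = ae_class M h"
    by (auto simp: Lp_space_def)
  note [measurable] = fgh[THEN Lp_fun_measurable]
  have "Lp_norm M p (\<lambda>w. (f w - g w) + (g w - h w))
          \<le> Lp_norm M p (\<lambda>w. f w - g w) + Lp_norm M p (\<lambda>w. g w - h w)"
    by (intro Minkowski(2) Lp_fun_diff p fgh)
  then show "Lp_dist M p F H \<le> Lp_dist M p F G + Lp_dist M p G H"
    by (simp add: FGH Lp_dist_ae_class)
qed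

lemma topspace_Lp_topology: "1 \<le> p \<Longrightarrow> topspace (Lp_topology M p) = Lp_space M p"
  by (simp add: Lp_topology_def Metric_space.topspace_mtopology Metric_space_Lp)

section \<open>Invariance\<close>

text \<open>
  Both properties are stated through representatives; neither the law of \<open>(f, g)\<close> nor the
  classes of \<open>f \<circ> u\<close> and \<open>g \<circ> u\<close> depend on them.
\<close>

definition mp_invariant ::
    "'a measure \<Rightarrow> real \<Rightarrow> real \<Rightarrow>
     (('a \<Rightarrow> 'x::{banach, second_countable_topology}) set \<times>
      ('a \<Rightarrow> 'y::{banach, second_countable_topology}) set) set \<Rightarrow> bool" where
  "mp_invariant M p q B \<longleftrightarrow>
     (\<forall>f\<in>Lp_fun M p. \<forall>g\<in>Lp_fun M q. \<forall>u\<in>mp_isos M.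
        (ae_class M f, ae_class M g) \<in> B \<longrightarrow> (ae_class M (f \<circ> u), ae_class M (g \<circ> u)) \<in> B)"

definition law_invariant ::
    "'a measure \<Rightarrow> real \<Rightarrow> real \<Rightarrow>
     (('a \<Rightarrow> 'x::{banach, second_countable_topology}) set \<times>
      ('a \<Rightarrow> 'y::{banach, second_countable_topology}) set) set \<Rightarrow> bool" where
  "law_invariant M p q B \<longleftrightarrow>
     (\<forall>f\<in>Lp_fun M p. \<forall>g\<in>Lp_fun M q. \<forall>f'\<in>Lp_fun M p. \<forall>g'\<in>Lp_fun M q.
        (ae_class M f, ae_class M g) \<in> B \<and>
        distr M borel (\<lambda>w. (f w, g w)) = distr M borel (\<lambda>w. (f' w, g' w)) \<longrightarrow>
        (ae_class M f', ae_class M g') \<in> B)"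

definition op_graph :: "'c set \<Rightarrow> ('c \<Rightarrow> 'd) \<Rightarrow> ('c \<times> 'd) set" where
  "op_graph D L = {(F, L F) | F. F \<in> D}"

end

theory Submission
  imports Defs
begin

text \<open>
The heart of the matter is that a nonatomic standard Borel probability space has enough
measure-preserving maps: if two maps \<open>f\<close>, \<open>f'\<close> into a separable metric space have the same law,
then for each \<open>\<epsilon> > 0\<close> there is an essentially injective, measure-preserving \<open>u\<close> such that \<open>f \<circ> u\<close> is
uniformly \<open>\<epsilon>\<close>-close to \<open>f'\<close> off a null set (\<open>equal_law_approximation\<close>). Granting this, let
\<open>(f, g)\<close> be in the closure of an invariant set \<open>B\<close> and let \<open>(f', g')\<close> have the same law. A pair
\<open>(h, k)\<close> of \<open>B\<close> close to \<open>(f, g)\<close> is moved by \<open>u\<close> to a pair of \<open>B\<close>, and since composition with \<open>u\<close>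
is isometric, \<open>(h \<circ> u, k \<circ> u)\<close> is close to \<open>(f \<circ> u, g \<circ> u)\<close>, hence to \<open>(f', g')\<close>
(\<open>law_invariant_closure\<close>). Conversely, composition with a measure-preserving map does not change
laws, so the two notions of invariance agree on closed sets; and the graph of a continuous operator
with closed domain is closed.

To find \<open>u\<close>, the target is partitioned into countably many Borel sets of small diameter. As \<open>f\<close> and
\<open>f'\<close> have the same law, the preimages of each piece have the same measure, and \<open>u\<close> only has to map
one preimage into the other. The space is identified with a measurable subset of the line
(\<open>standard_borel_embedding\<close>), where distribution functions and quantiles give an explicit
measure-preserving matching, the monotone rearrangement (\<open>monotone_rearrangement\<close>).
If the coordinates on the line are chosen so that the preimages of the pieces
lie in consecutive intervals, the rearrangement respects them (\<open>label_matching\<close>).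
\<close>

section \<open>Real coordinates on standard Borel spaces\<close>

text \<open>
Base 4 with digits 0 and 1 only: the tail after a digit never reaches a full unit of that digit,
so each digit is recovered by rounding down, with no ambiguous expansions to be excluded.
\<close>

definition quaternary :: "(nat \<Rightarrow> bool) \<Rightarrow> real" where
  "quaternary y = (\<Sum>k. of_bool (y k) / 4 ^ Suc k)"

definition digit :: "nat \<Rightarrow> real \<Rightarrow> bool" where
  "digit n t \<longleftrightarrow> odd \<lfloor>4 ^ Suc n * t\<rfloor>"

lemma summable_quaternary: "summable (\<lambda>k. of_bool (y k) / 4 ^ Suc k :: real)"
proof (rule summable_comparison_test')
  show "summable (\<lambda>k. (1 / 4 :: real) ^ k)" by (simp add: summable_geometric)
  show "norm (of_bool (y k) / 4 ^ Suc k :: real) \<le> (1 / 4) ^ k" if "k \<ge> 0" for k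
    by (simp add: power_one_over divide_simps)
qed

lemma quaternary_range: "0 \<le> quaternary y" "quaternary y < 1"
proof -
  show "0 \<le> quaternary y"
    unfolding quaternary_def by (intro suminf_nonneg summable_quaternary) simp
  have s: "(\<lambda>k. 1 / 4 * (1 / 4) ^ k) sums (1 / 4 * (1 / (1 - 1 / 4)) :: real)"
    by (intro sums_mult geometric_sums) simp
  have "quaternary y \<le> (\<Sum>k. 1 / 4 * (1 / 4) ^ k)"
    unfolding quaternary_def
    by (intro suminf_le summable_quaternary sums_summable[OF s])
      (simp add: power_one_over divide_simps)
  also have "\<dots> < 1" using sums_unique[OF s] by simp
  finally show "quaternary y < 1" .
qed

lemma quaternary_shift: "4 * quaternary y = of_bool (y 0) + quaternary (\<lambda>k. y (Suc k))"
proof -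
  have "quaternary y = of_bool (y 0) / 4 + (\<Sum>k. of_bool (y (Suc k)) / 4 ^ Suc (Suc k))"
    unfolding quaternary_def using suminf_split_head[OF summable_quaternary[of y]] by simp
  also have "(\<Sum>k. of_bool (y (Suc k)) / 4 ^ Suc (Suc k) :: real) =
      (\<Sum>k. 1 / 4 * (of_bool (y (Suc k)) / 4 ^ Suc k))"
    by simp
  also have "\<dots> = 1 / 4 * quaternary (\<lambda>k. y (Suc k))"
    unfolding quaternary_def by (intro suminf_mult summable_quaternary)
  finally show ?thesis by simp
qed

lemma digit_quaternary: "digit n (quaternary y) \<longleftrightarrow> y n"
proof (induction n arbitrary: y)
  case 0
  have "\<lfloor>4 * quaternary y\<rfloor> = of_bool (y 0)"
    unfolding quaternary_shift using quaternary_range[of "\<lambda>k. y (Suc k)"]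
    by (intro floor_unique) auto
  then show ?case by (simp add: digit_def)
next
  case (Suc n)
  let ?y = "\<lambda>k. y (Suc k)"
  have "4 ^ Suc (Suc n) * quaternary y = 4 ^ Suc n * (4 * quaternary y)" by simp
  also have "\<dots> = of_int (4 ^ Suc n * of_bool (y 0)) + 4 ^ Suc n * quaternary ?y"
    by (simp add: quaternary_shift distrib_left)
  finally have "\<lfloor>4 ^ Suc (Suc n) * quaternary y\<rfloor> =
      4 ^ Suc n * of_bool (y 0) + \<lfloor>4 ^ Suc n * quaternary ?y\<rfloor>"
    by (metis add.commute floor_add_int)
  then show ?case
    using Suc.IH[of ?y] by (simp add: digit_def)
qed

lemma measurable_digit [measurable]: "Measurable.pred borel (digit n)"
  unfolding digit_def by measurable

text \<open>
A point \<open>x\<close> is determined by the list of those balls that contain it, among the balls of radius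
\<open>1 / (n + 1)\<close> around the points of a countable dense set; \<open>e x\<close> codes this list. The left inverse is built so that its measurability is visible: from the digits of \<open>t\<close> one reads off, for
each \<open>n\<close>, the first dense point whose ball of radius \<open>1 / (n + 1)\<close> is marked, and \<open>c t\<close> is the
limit of these points whenever they form a Cauchy sequence. The Cauchy condition is a countable
combination of measurable ones, and distances to \<open>c t\<close> are limits of measurable functions.
The image of \<open>e\<close> is then \<open>{t. e (c t) = t}\<close>, a Borel set, with no appeal to the theorem of Lusin
and Souslin.
\<close>

lemma standard_borel_embedding:
  assumes "standard_borel M" and ne: "space M \<noteq> {}"
  obtains e :: "'a \<Rightarrow> real" and c where
    "e \<in> borel_measurable M" "c \<in> measurable borel M"
    "\<And>x. x \<in> space M \<Longrightarrow> c (e x) = x" "\<And>x. 0 \<le> e x" "\<And>x. e x < 1"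
proof -
  obtain T where T: "completely_metrizable_space T" "separable_space T" "topspace T = space M"
    and sets_M: "sets M = sigma_sets (space M) {U. openin T U}"
    using assms(1) by (auto simp: standard_borel_def)
  obtain X d where X: "Metric_space X d" "Metric_space.mcomplete X d"
    and T_eq: "T = Metric_space.mtopology X d"
    using T(1) by (auto simp: completely_metrizable_space_def)
  interpret Metric_space X d by fact
  have space_M: "space M = X" using T(3) by (simp add: T_eq)
  obtain C where C: "countable C" "C \<subseteq> X" "mtopology closure_of C = X"
    using T(2) unfolding separable_space_def T_eq by auto
  have "C \<noteq> {}" using C(3) ne space_M by auto
  define a where "a = from_nat_into C"
  have a_in [simp]: "a i \<in> X" for i
    using from_nat_into[OF \<open>C \<noteq> {}\<close>] C(2) by (auto simp: a_def)
  have a_dense: "\<exists>i. d (a i) x < r" if x: "x \<in> X" and r: "0 < r" for x r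
  proof -
    have "x \<in> mtopology closure_of C" using C(3) x by simp
    then obtain y where "y \<in> C" "d x y < r"
      using r unfolding metric_closure_of by (auto simp: in_mball)
    then show ?thesis
      using from_nat_into_surj[OF C(1)] commute unfolding a_def by metis
  qed
  have ball_sets: "mball x r \<in> sets M" for x r
    unfolding sets_M T_eq by (rule sigma_sets.Basic) simp
  \<comment> \<open>Whether \<open>x\<close> lies in the ball with index \<open>k\<close>, where \<open>k\<close> codes the radius and the centre.\<close>
  define near where "near x k = (case prod_decode k of (n, i) \<Rightarrow> d (a i) x < 1 / real (Suc n))"
    for x k
  define e where "e x = quaternary (near x)" for x
  have near_meas [measurable]: "Measurable.pred M (\<lambda>x. near x k)" for k
  proof -
    obtain n i where k: "prod_decode k = (n, i)" by force
    have "{x \<in> space M. near x k} = mball (a i) (1 / real (Suc n))"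
      by (auto simp: near_def k space_M)
    then show ?thesis unfolding pred_def using ball_sets by simp
  qed
  have e_meas: "e \<in> borel_measurable M"
    unfolding e_def quaternary_def by (intro borel_measurable_suminf) measurable
  define idx where "idx n t = (LEAST i. digit (prod_encode (n, i)) t)" for n t
  have idx_meas [measurable]: "idx n \<in> measurable borel (count_space UNIV)" for n
    unfolding idx_def by measurable
  have idx_e: "d (a (idx n (e x))) x < 1 / real (Suc n)" if "x \<in> X" for n x
  proof -
    have "idx n (e x) = (LEAST i. d (a i) x < 1 / real (Suc n))"
      by (simp add: idx_def e_def digit_quaternary near_def)
    moreover have "d (a (LEAST i. d (a i) x < 1 / real (Suc n))) x < 1 / real (Suc n)"
      by (rule LeastI_ex, rule a_dense[OF that]) simp
    ultimately show ?thesis by simp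
  qed
  define good where "good t \<longleftrightarrow> MCauchy (\<lambda>n. a (idx n t))" for t
  have good_iff: "good t \<longleftrightarrow>
     (\<forall>k. \<exists>N. \<forall>n\<ge>N. \<forall>m\<ge>N. d (a (idx n t)) (a (idx m t)) < 1 / real (Suc k))" for t
    unfolding good_def MCauchy_def
  proof (intro iffI conjI allI impI)
    fix k assume "range (\<lambda>n. a (idx n t)) \<subseteq> X \<and>
      (\<forall>\<epsilon>>0. \<exists>N. \<forall>n n'. N \<le> n \<longrightarrow> N \<le> n' \<longrightarrow> d (a (idx n t)) (a (idx n' t)) < \<epsilon>)"
    then show "\<exists>N. \<forall>n\<ge>N. \<forall>m\<ge>N. d (a (idx n t)) (a (idx m t)) < 1 / real (Suc k)"
      by (metis of_nat_0_less_iff zero_less_Suc zero_less_divide_1_iff)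
  next
    fix \<epsilon> :: real assume \<epsilon>: "0 < \<epsilon>"
      and *: "\<forall>k. \<exists>N. \<forall>n\<ge>N. \<forall>m\<ge>N. d (a (idx n t)) (a (idx m t)) < 1 / real (Suc k)"
    obtain k where "1 / real (Suc k) < \<epsilon>" using nat_approx_posE[OF \<epsilon>] .
    then show "\<exists>N. \<forall>n n'. N \<le> n \<longrightarrow> N \<le> n' \<longrightarrow> d (a (idx n t)) (a (idx n' t)) < \<epsilon>"
      using * by (meson order.strict_trans)
  qed auto
  have [measurable]: "(\<lambda>t. d (a (idx n t)) (a (idx m t))) \<in> borel_measurable borel" for n m
    by (rule measurable_compose_countable[of "\<lambda>i t. d (a i) (a (idx m t))"],
        rule measurable_compose_countable[of "\<lambda>j t. d (a _) (a j)"]) auto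
  have [measurable]: "(\<lambda>t. d b (a (idx m t))) \<in> borel_measurable borel" for m b
    by (rule measurable_compose_countable[of "\<lambda>j t. d b (a j)"]) auto
  have [measurable]: "Measurable.pred borel good"
    unfolding good_iff by measurable
  \<comment> \<open>The value \<open>a 0\<close> is arbitrary; it keeps \<open>c\<close> total with values in the space.\<close>
  define c where "c t = (if good t then SOME x. limitin mtopology (\<lambda>n. a (idx n t)) x sequentially
      else a 0)" for t
  have c_lim: "limitin mtopology (\<lambda>n. a (idx n t)) (c t) sequentially" if "good t" for t
  proof -
    have "\<exists>x. limitin mtopology (\<lambda>n. a (idx n t)) x sequentially"
      using that X(2) unfolding mcomplete_def good_def by blast
    from someI_ex[OF this] that show ?thesis by (simp add: c_def)
  qed
  have c_in: "c t \<in> X" for t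
    using c_lim[of t] limitin_metric by (cases "good t") (auto simp: c_def)
  have c_dist [measurable]: "(\<lambda>t. d b (c t)) \<in> borel_measurable borel" if b: "b \<in> X" for b
  proof (rule borel_measurable_LIMSEQ_real)
    show "(\<lambda>t. if good t then d b (a (idx n t)) else d b (a 0)) \<in> borel_measurable borel" for n
      by measurable
    fix t
    show "(\<lambda>n. if good t then d b (a (idx n t)) else d b (a 0)) \<longlonglongrightarrow> d b (c t)"
    proof (cases "good t")
      case True
      have "(\<lambda>n. d (a (idx n t)) (c t)) \<longlonglongrightarrow> 0"
        using c_lim[OF True] by (simp add: limitin_metric_dist_null)
      then have "(\<lambda>n. d b (a (idx n t)) - d b (c t)) \<longlonglongrightarrow> 0"
      proof (rule Lim_null_comparison[rotated], intro always_eventually allI)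
        fix n
        show "norm (d b (a (idx n t)) - d b (c t)) \<le> d (a (idx n t)) (c t)"
          using triangle[of b "a (idx n t)" "c t"] triangle[of b "c t" "a (idx n t)"]
            b c_in[of t] commute[of "c t" "a (idx n t)"] by auto
      qed
      then show ?thesis using True by (simp add: LIM_zero_iff)
    qed (simp add: c_def)
  qed
  have c_meas: "c \<in> measurable borel M"
  proof (rule measurable_sigma_sets[OF sets_M])
    show "{U. openin T U} \<subseteq> Pow (space M)" using openin_subset T(3) by auto
    show "c \<in> space borel \<rightarrow> space M" using c_in space_M by auto
    fix U assume "U \<in> {U. openin T U}"
    then have U: "openin mtopology U" by (simp add: T_eq)
    have "c t \<in> U \<longleftrightarrow> (\<exists>i n. mball (a i) (1 / real (Suc n)) \<subseteq> U \<and> d (a i) (c t) < 1 / real (Suc n))" for t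
    proof
      assume "c t \<in> U"
      then obtain r where r: "r > 0" "mball (c t) r \<subseteq> U"
        using U unfolding openin_mtopology by auto
      obtain n where n: "1 / real (Suc n) < r / 2" using nat_approx_posE[of "r / 2"] r by auto
      obtain i where i: "d (a i) (c t) < 1 / real (Suc n)"
        using a_dense[OF c_in[of t], of "1 / real (Suc n)"] by (auto simp del: of_nat_Suc)
      have "mball (a i) (1 / real (Suc n)) \<subseteq> mball (c t) r"
      proof
        fix y assume "y \<in> mball (a i) (1 / real (Suc n))"
        then have y: "y \<in> X" "d (a i) y < 1 / real (Suc n)" by (auto simp: in_mball)
        then have "d (c t) y \<le> d (a i) (c t) + d (a i) y"
          using triangle[of "c t" "a i" y] c_in[of t] commute[of "c t" "a i"] by simp
        then show "y \<in> mball (c t) r" using y i n c_in[of t] by (simp add: in_mball del: of_nat_Suc)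
      qed
      then show "\<exists>i n. mball (a i) (1 / real (Suc n)) \<subseteq> U \<and> d (a i) (c t) < 1 / real (Suc n)"
        using r i by blast
    qed (use c_in in \<open>auto simp: subset_iff in_mball\<close>)
    then have "c -` U \<inter> space borel =
       {t \<in> space borel. \<exists>i n. mball (a i) (1 / real (Suc n)) \<subseteq> U \<and> d (a i) (c t) < 1 / real (Suc n)}"
      by auto
    also have "\<dots> \<in> sets borel" by measurable
    finally show "c -` U \<inter> space borel \<in> sets borel" .
  qed
  have "c (e x) = x" if x: "x \<in> space M" for x
  proof -
    have xX: "x \<in> X" using x space_M by simp
    have lim: "limitin mtopology (\<lambda>n. a (idx n (e x))) x sequentially"
      unfolding limitin_metric_dist_null
    proof (intro conjI xX always_eventually allI a_in)
      show "(\<lambda>n. d (a (idx n (e x))) x) \<longlonglongrightarrow> 0"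
      proof (rule tendsto_sandwich[OF _ _ tendsto_const LIMSEQ_inverse_real_of_nat])
        show "\<forall>\<^sub>F n in sequentially. d (a (idx n (e x))) x \<le> inverse (real (Suc n))"
          using idx_e[OF xX] by (auto intro!: always_eventually less_imp_le simp: inverse_eq_divide)
      qed simp
    qed
    have "good (e x)"
      unfolding good_def by (rule convergent_imp_MCauchy[OF _ lim]) auto
    from limitin_metric_unique[OF c_lim[OF this] lim] show ?thesis by simp
  qed
  moreover have "0 \<le> e x" "e x < 1" for x
    unfolding e_def by (rule quaternary_range)+
  ultimately show ?thesis using that e_meas c_meas by blast
qed

section \<open>Monotone rearrangement\<close>

text \<open>
A nonatomic probability space with an injective real coordinate \<open>e\<close> and a measurable left inverse
\<open>c\<close>. Such a space is isomorphic modulo null sets to the unit interval: \<open>rank \<circ> e\<close> leads to the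
interval and \<open>c \<circ> quantile\<close> leads back.
\<close>

locale real_coordinate = prob_space M for M :: "'a measure" +
  fixes e :: "'a \<Rightarrow> real" and c :: "real \<Rightarrow> 'a"
  assumes e [measurable]: "e \<in> borel_measurable M"
    and c [measurable]: "c \<in> measurable borel M"
    and c_e: "x \<in> space M \<Longrightarrow> c (e x) = x"
    and null_points: "x \<in> space M \<Longrightarrow> measure M {x} = 0"
begin

definition law :: "real measure" where "law = distr M borel e"

definition rank :: "real \<Rightarrow> real" where "rank = cdf law"

definition quantile :: "real \<Rightarrow> real" where "quantile t = (if 0 < t \<and> t < 1 then Inf {s. t \<le> rank s} else 0)"

sublocale law: cdf_distribution law
  unfolding cdf_distribution_def law_def by (rule real_distribution_distr) simp

lemma measurable_rank [measurable]: "rank \<in> borel_measurable borel"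
  unfolding rank_def by (rule law.measurable_C)

lemma measurable_quantile [measurable]: "quantile \<in> borel_measurable borel"
proof -
  have "(\<lambda>t. Inf {s. t \<le> rank s}) \<in> borel_measurable (restrict_space borel {0<..<1})"
    unfolding rank_def by (rule law.measurable_CI)
  moreover have "{0<..<1} = {t :: real. 0 < t \<and> t < 1}" by auto
  ultimately show ?thesis
    unfolding quantile_def by (subst measurable_If_restrict_space_iff) simp_all
qed

lemma quantile_le_iff: "0 < t \<Longrightarrow> t < 1 \<Longrightarrow> quantile t \<le> s \<longleftrightarrow> t \<le> rank s"
  using law.pseudoinverse[of t s] unfolding quantile_def rank_def by simp

text \<open>
Jumps of the distribution function are atoms of \<open>law\<close>, and an atom of \<open>law\<close> would pull back along
the injective \<open>e\<close> to an atom of \<open>M\<close>.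
\<close>

lemma isCont_rank: "isCont rank s"
proof -
  have "measure law {s} = measure M (e -` {s} \<inter> space M)"
    unfolding law_def by (rule measure_distr) auto
  also have "\<dots> = 0"
  proof (cases "e -` {s} \<inter> space M = {}")
    case False
    then obtain x where "x \<in> space M" "e x = s" by auto
    have "y = x" if "y \<in> e -` {s} \<inter> space M" for y
      using that c_e[of y] c_e[of x] \<open>x \<in> space M\<close> \<open>e x = s\<close> by simp
    then have "e -` {s} \<inter> space M = {x}"
      using \<open>x \<in> space M\<close> \<open>e x = s\<close> by blast
    then show ?thesis using null_points \<open>x \<in> space M\<close> by simp
  qed simp
  finally show ?thesis unfolding rank_def by (simp add: law.isCont_cdf)
qed

text \<open>
Just below the quantile of level \<open>t\<close> the distribution function is at most \<open>t\<close>; by continuity it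
cannot overshoot \<open>t\<close> at the quantile.
\<close>

lemma rank_quantile:
  assumes "0 < t" "t < 1"
  shows "rank (quantile t) = t"
proof (rule antisym)
  show "t \<le> rank (quantile t)" using quantile_le_iff[OF assms, of "quantile t"] by simp
  have "((\<lambda>s. rank s) \<longlongrightarrow> rank (quantile t)) (at_left (quantile t))"
    using isCont_rank[of "quantile t"] unfolding isCont_def by (rule filterlim_mono) (auto simp: at_le)
  moreover have "\<forall>\<^sub>F s in at_left (quantile t). rank s \<le> t"
    unfolding eventually_at_filter
  proof (intro always_eventually allI impI)
    fix s assume "s \<in> {..<quantile t}"
    then show "rank s \<le> t" using quantile_le_iff[OF assms, of s] by auto
  qed
  ultimately show "rank (quantile t) \<le> t"
    by (rule tendsto_upperbound) simp
qed

lemma distr_quantile: "distr (restrict_space lborel {0<..<1}) borel quantile = law"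
proof -
  have "distr (restrict_space lborel {0<..<1}) borel quantile =
      distr (restrict_space lborel {0<..<1}) borel (\<lambda>t. Inf {s. t \<le> cdf law s})"
  proof (rule distr_cong)
    fix t :: real assume "t \<in> space (restrict_space lborel {0<..<1})"
    then show "quantile t = Inf {s. t \<le> cdf law s}"
      by (simp add: quantile_def rank_def space_restrict_space)
  qed (rule refl)+
  also have "\<dots> = law" by (rule law.distr_I_eq_M)
  finally show ?thesis .
qed

lemma distr_rank: "distr law borel rank = distr (restrict_space lborel {0<..<1}) borel (\<lambda>t. t)"
proof -
  have [measurable]: "quantile \<in> borel_measurable (restrict_space lborel {0<..<1})"
    by (intro measurable_restrict_space1) simp
  have "distr law borel rank = distr (restrict_space lborel {0<..<1}) borel (rank \<circ> quantile)"
    by (subst distr_quantile[symmetric], rule distr_distr) auto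
  also have "\<dots> = distr (restrict_space lborel {0<..<1}) borel (\<lambda>t. t)"
    by (rule distr_cong) (simp_all add: space_restrict_space rank_quantile)
  finally show ?thesis .
qed

lemma AE_law_iff:
  assumes [measurable]: "Measurable.pred borel P"
  shows "(AE s in law. P s) \<longleftrightarrow> (AE x in M. P (e x))"
  unfolding law_def by (rule AE_distr_iff) auto

text \<open>
\<open>quantile \<circ> rank\<close> fixes every value of \<open>quantile\<close> on the open unit interval, and \<open>law\<close> is
carried by these values. So \<open>rank\<close> is injective off a null set,
although the distribution function may have flat pieces.
\<close>

lemma AE_quantile_rank: "AE x in M. 0 < rank (e x) \<and> rank (e x) < 1 \<and> quantile (rank (e x)) = e x"
proof -
  have [measurable]: "quantile \<in> borel_measurable (restrict_space lborel {0<..<1})"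
    by (intro measurable_restrict_space1) simp
  have "AE s in distr (restrict_space lborel {0<..<1}) borel quantile.
      0 < rank s \<and> rank s < 1 \<and> quantile (rank s) = s"
    by (subst AE_distr_iff) (auto intro!: AE_I2 simp: space_restrict_space rank_quantile)
  then show ?thesis
    unfolding distr_quantile by (rule AE_law_iff[THEN iffD1, rotated]) measurable
qed

end

lemma distr_transport:
  assumes "real_coordinate M e c" "real_coordinate M e' c'"
  shows "distr M borel (\<lambda>x. real_coordinate.quantile M e (real_coordinate.rank M e' (e' x))) =
    real_coordinate.law M e"
proof -
  interpret A: real_coordinate M e c by fact
  interpret B: real_coordinate M e' c' by fact
  have "distr M borel (\<lambda>x. A.quantile (B.rank (e' x))) = distr (distr B.law borel B.rank) borel A.quantile"
    unfolding B.law_def by (simp add: distr_distr comp_def)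
  also have "\<dots> = distr (restrict_space lborel {0<..<1}) borel A.quantile"
    unfolding B.distr_rank by (subst distr_distr) (auto simp: comp_def intro!: measurable_restrict_space1)
  also have "\<dots> = A.law" by (rule A.distr_quantile)
  finally show ?thesis .
qed

text \<open>
The left inverse is a genuine one off some measurable null set, and \<open>u\<close> is injective there.
\<close>

lemma mp_isosI:
  assumes "prob_space M" and [measurable]: "u \<in> measurable M M" and "distr M M u = M"
    and inv: "AE x in M. v (u x) = x"
  shows "u \<in> mp_isos M"
proof -
  interpret prob_space M by fact
  obtain Z where Z: "\<And>x. x \<in> space M - Z \<Longrightarrow> v (u x) = x" "Z \<in> null_sets M"
    using inv by (rule AE_E3) (rule that)
  have "inj_on u (space M - Z)"
    by (rule inj_on_inverseI[where g = v]) (rule Z(1))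
  moreover have "emeasure M (space M - Z) = 1"
    using Z by (simp add: emeasure_Diff_null_set emeasure_space_1)
  moreover have "space M - Z \<in> sets M" using Z by auto
  ultimately show ?thesis using assms(2,3) unfolding mp_isos_def by blast
qed

text \<open>
Two coordinates \<open>e\<close> and \<open>e'\<close> on the same space are matched by sending the point of coordinate \<open>e' x\<close>
to the point with the same rank for \<open>e\<close>. Exchanging the two coordinates gives the inverse modulo
null sets. If the two distribution functions agree at a level \<open>s\<close>, the matching respects the cut
at \<open>s\<close>; this is what later forces the matching to respect a given partition of the space.
\<close>

lemma monotone_rearrangement:
  assumes "real_coordinate M e c" "real_coordinate M e' c'"
  obtains u where "u \<in> mp_isos M"
    "AE x in M. \<forall>s. cdf (distr M borel e) s = cdf (distr M borel e') s \<longrightarrow> (e (u x) \<le> s \<longleftrightarrow> e' x \<le> s)"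
proof -
  interpret A: real_coordinate M e c by fact
  interpret B: real_coordinate M e' c' by fact
  define T where "T x = A.quantile (B.rank (e' x))" for x
  define u where "u x = c (T x)" for x
  define v where "v y = c' (B.quantile (A.rank (e y)))" for y
  have [measurable]: "T \<in> borel_measurable M" unfolding T_def by measurable
  have u [measurable]: "u \<in> measurable M M" unfolding u_def by measurable
  have T: "distr M borel T = A.law"
    unfolding T_def using distr_transport[OF assms] .
  \<comment> \<open>\<open>e \<circ> c\<close> fixes the values of \<open>e\<close>, and \<open>T\<close> takes its values there almost surely,
    having the same law as \<open>e\<close>.\<close>
  have e_u: "AE x in M. e (u x) = T x"
  proof -
    have "AE s in A.law. e (c s) = s"
      by (subst A.AE_law_iff) (auto simp: A.c_e)
    then show ?thesis
      unfolding T[symmetric] u_def by (subst (asm) AE_distr_iff) auto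
  qed
  have "distr M M u = distr (distr M borel T) M c"
    unfolding u_def by (subst distr_distr) (auto simp: comp_def)
  also have "\<dots> = distr M M (c \<circ> e)"
    unfolding T A.law_def by (rule distr_distr) auto
  also have "\<dots> = distr M M (\<lambda>x. x)"
    by (rule distr_cong) (auto simp: A.c_e)
  finally have "distr M M u = M" by simp
  moreover have "AE x in M. v (u x) = x"
    using B.AE_quantile_rank e_u AE_space
    by eventually_elim (simp add: v_def T_def A.rank_quantile B.c_e)
  ultimately have "u \<in> mp_isos M"
    using A.prob_space_axioms by (intro mp_isosI) auto
  moreover have "AE x in M. \<forall>s. cdf (distr M borel e) s = cdf (distr M borel e') s
      \<longrightarrow> (e (u x) \<le> s \<longleftrightarrow> e' x \<le> s)"
    using B.AE_quantile_rank e_u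
  proof eventually_elim
    case (elim x)
    let ?t = "B.rank (e' x)"
    have t: "0 < ?t" "?t < 1" "B.quantile ?t = e' x" using elim by auto
    show ?case
    proof (intro allI impI)
      fix s assume "cdf (distr M borel e) s = cdf (distr M borel e') s"
      then have "A.rank s = B.rank s" by (simp add: A.rank_def B.rank_def A.law_def B.law_def)
      then show "e (u x) \<le> s \<longleftrightarrow> e' x \<le> s"
        using A.quantile_le_iff[OF t(1,2), of s] B.quantile_le_iff[OF t(1,2), of s] t elim by (simp add: T_def)
    qed
  qed
  ultimately show ?thesis using that by blast
qed

text \<open>
A point of positive measure has no subset of smaller positive measure.
\<close>

lemma nonatomic_null_point:
  assumes "prob_space M" "nonatomic M"
  shows "measure M {x} = 0"
proof (rule ccontr)
  assume *: "measure M {x} \<noteq> 0"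
  interpret prob_space M by fact
  have "{x} \<in> sets M" using * measure_notin_sets by metis
  moreover have "0 < emeasure M {x}" using * by (simp add: emeasure_eq_measure zero_less_measure_iff)
  ultimately obtain A where "A \<subseteq> {x}" "0 < emeasure M A" "emeasure M A < emeasure M {x}"
    using assms(2) unfolding nonatomic_def by blast
  then show False by (cases "A = {}") (auto simp: subset_singleton_iff)
qed

section \<open>Approximating a map by rearranging another of the same law\<close>

text \<open>
The matching must send each set \<open>{K' = n}\<close> into \<open>{K = n}\<close>. Instead of matching these pieces one by
one and gluing, the labels are built into the coordinate: \<open>K - e\<close> takes its values on
\<open>{K = n}\<close> in \<open>(n - 1, n]\<close>, so the pieces become consecutive blocks of the line, separated by the
cuts at the natural numbers. Equality of the laws of \<open>K\<close> and \<open>K'\<close> says that the distribution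
functions of \<open>K - e\<close> and \<open>K' - e\<close> agree at these cuts.
\<close>

lemma label_matching:
  fixes K K' :: "'a \<Rightarrow> nat"
  assumes M: "prob_space M" "standard_borel M" "nonatomic M"
    and [measurable]: "K \<in> measurable M (count_space UNIV)" "K' \<in> measurable M (count_space UNIV)"
    and law: "distr M (count_space UNIV) K = distr M (count_space UNIV) K'"
  obtains u where "u \<in> mp_isos M" "AE x in M. K (u x) = K' x"
proof -
  interpret prob_space M by fact
  obtain e :: "'a \<Rightarrow> real" and c :: "real \<Rightarrow> 'a"
    where [measurable]: "e \<in> borel_measurable M" "c \<in> measurable borel M"
      and c_e: "\<And>x. x \<in> space M \<Longrightarrow> c (e x) = x"
      and e_range: "\<And>x. 0 \<le> e x" "\<And>x. e x < 1"
    by (rule standard_borel_embedding[OF M(2) not_empty]) (rule that)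
  have ceiling: "\<lceil>real k - e x\<rceil> = int k" for k x
    using e_range[of x] by (intro ceiling_unique) auto
  have le_iff: "real k - e x \<le> real n \<longleftrightarrow> k \<le> n" for k n x
  proof
    assume "real k - e x \<le> real n"
    then have "real k < real (Suc n)" using e_range(2)[of x] by simp
    then show "k \<le> n" by (simp only: of_nat_less_iff less_Suc_eq_le)
  next
    assume "k \<le> n"
    then show "real k - e x \<le> real n" using e_range(1)[of x] by linarith
  qed
  have coordinate: "real_coordinate M (\<lambda>x. real (L x) - e x) (\<lambda>t. c (of_int \<lceil>t\<rceil> - t))"
    if [measurable]: "L \<in> measurable M (count_space UNIV)" for L :: "'a \<Rightarrow> nat"
  proof
    show "c (of_int \<lceil>real (L x) - e x\<rceil> - (real (L x) - e x)) = x" if "x \<in> space M" for x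
      using c_e[OF that] by (simp add: ceiling)
    show "measure M {x} = 0" for x by (rule nonatomic_null_point[OF M(1,3)])
  qed measurable
  have cdf_nat: "cdf (distr M borel (\<lambda>x. real (L x) - e x)) (real n) =
      measure (distr M (count_space UNIV) L) {..n}"
    if [measurable]: "L \<in> measurable M (count_space UNIV)" for L n
  proof -
    have "cdf (distr M borel (\<lambda>x. real (L x) - e x)) (real n) =
        measure M ((\<lambda>x. real (L x) - e x) -` {..real n} \<inter> space M)"
      unfolding cdf_def by (rule measure_distr) auto
    also have "(\<lambda>x. real (L x) - e x) -` {..real n} \<inter> space M = L -` {..n} \<inter> space M"
      by (auto simp: le_iff)
    also have "measure M \<dots> = measure (distr M (count_space UNIV) L) {..n}"
      by (rule measure_distr[symmetric]) auto
    finally show ?thesis .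
  qed
  obtain u where u: "u \<in> mp_isos M" and
    AE: "AE x in M. \<forall>s. cdf (distr M borel (\<lambda>x. real (K x) - e x)) s =
        cdf (distr M borel (\<lambda>x. real (K' x) - e x)) s \<longrightarrow>
      (real (K (u x)) - e (u x) \<le> s \<longleftrightarrow> real (K' x) - e x \<le> s)"
    using monotone_rearrangement[OF coordinate[of K] coordinate[of K']] by auto
  have "AE x in M. K (u x) = K' x"
    using AE
  proof eventually_elim
    case (elim x)
    have "K (u x) \<le> n \<longleftrightarrow> K' x \<le> n" for n
      using elim[THEN spec, of "real n"] by (simp add: cdf_nat law le_iff)
    then show ?case by (metis nle_le)
  qed
  then show ?thesis using u that by blast
qed

text \<open>
The target is cut into countably many pieces of diameter at most \<open>\<epsilon>\<close>, by labelling each value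
with the first point of a dense sequence at distance less than \<open>\<epsilon> / 2\<close>. Matching the labels of
\<open>f\<close> and \<open>f'\<close> puts \<open>f (u x)\<close> and \<open>f' x\<close> into the same piece.
\<close>

lemma equal_law_approximation:
  fixes f f' :: "'a \<Rightarrow> 'z::{metric_space, second_countable_topology}"
  assumes M: "prob_space M" "standard_borel M" "nonatomic M"
    and [measurable]: "f \<in> borel_measurable M" "f' \<in> borel_measurable M"
    and law: "distr M borel f = distr M borel f'" and \<epsilon>: "0 < \<epsilon>"
  obtains u where "u \<in> mp_isos M" "AE x in M. dist (f (u x)) (f' x) < \<epsilon>"
proof -
  obtain D :: "'z set" where D: "countable D" "\<And>X. open X \<Longrightarrow> X \<noteq> {} \<Longrightarrow> \<exists>d\<in>D. d \<in> X"
    by (rule countable_dense_setE) (rule that)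
  define K where "K z = (LEAST n. dist (from_nat_into D n) z < \<epsilon> / 2)" for z
  have K: "dist (from_nat_into D (K z)) z < \<epsilon> / 2" for z
  proof -
    obtain d where "d \<in> D" "d \<in> ball z (\<epsilon> / 2)" using D(2)[of "ball z (\<epsilon> / 2)"] \<epsilon> by auto
    moreover obtain n where "from_nat_into D n = d"
      using from_nat_into_surj[OF D(1) \<open>d \<in> D\<close>] by blast
    ultimately have "dist (from_nat_into D n) z < \<epsilon> / 2" by (simp add: dist_commute)
    then show ?thesis unfolding K_def by (rule LeastI)
  qed
  have [measurable]: "K \<in> measurable borel (count_space UNIV)"
    unfolding K_def by measurable
  have law': "distr M (count_space UNIV) (\<lambda>x. K (h x)) = distr (distr M borel h) (count_space UNIV) K"
    if [measurable]: "h \<in> borel_measurable M" for h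
    by (simp add: distr_distr comp_def)
  obtain u where u: "u \<in> mp_isos M" "AE x in M. K (f (u x)) = K (f' x)"
    by (rule label_matching[OF M, of "\<lambda>x. K (f x)" "\<lambda>x. K (f' x)"]) (auto simp: law' law)
  have "AE x in M. dist (f (u x)) (f' x) < \<epsilon>"
    using u(2)
  proof eventually_elim
    case (elim x)
    show ?case
      by (rule dist_triangle_half_l[of _ "from_nat_into D (K (f' x))"])
        (use K[of "f (u x)"] K[of "f' x"] elim in \<open>simp_all add: dist_commute\<close>)
  qed
  then show ?thesis using u that by blast
qed

section \<open>Rearrangements in Lebesgue spaces\<close>

lemma mp_isosD:
  assumes "u \<in> mp_isos M"
  shows "u \<in> measurable M M" "distr M M u = M"
  using assms by (auto simp: mp_isos_def)

lemma Lp_comp_mp_iso: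
  assumes u: "u \<in> mp_isos M" and f: "f \<in> Lp_fun M p"
  shows "f \<circ> u \<in> Lp_fun M p" and "Lp_norm M p (f \<circ> u) = Lp_norm M p f"
proof -
  note [measurable] = mp_isosD(1)[OF u] Lp_fun_measurable[OF f]
  have "integrable (distr M M u) (\<lambda>w. norm (f w) powr p)"
    using f by (simp add: mp_isosD(2)[OF u] Lp_fun_def)
  then show "f \<circ> u \<in> Lp_fun M p"
    by (subst (asm) integrable_distr_eq) (auto simp: Lp_fun_def)
  have "(\<integral>w. norm (f (u w)) powr p \<partial>M) = (\<integral>w. norm (f w) powr p \<partial>distr M M u)"
    by (rule integral_distr[symmetric]) measurable
  then show "Lp_norm M p (f \<circ> u) = Lp_norm M p f"
    by (simp add: Lp_norm_def mp_isosD(2)[OF u])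
qed

lemma Lp_norm_le_AE_bound:
  assumes "prob_space M" "1 \<le> p" "f \<in> Lp_fun M p" "AE w in M. norm (f w) \<le> r" "0 \<le> r"
  shows "Lp_norm M p f \<le> r"
proof -
  interpret prob_space M by fact
  have "(\<integral>w. norm (f w) powr p \<partial>M) \<le> (\<integral>w. r powr p \<partial>M)"
  proof (rule integral_mono_AE)
    show "AE w in M. norm (f w) powr p \<le> r powr p"
      using assms(4) by eventually_elim (use assms(2) in \<open>auto intro: powr_mono2\<close>)
  qed (use assms in \<open>auto simp: Lp_fun_def\<close>)
  then have "Lp_norm M p f \<le> (r powr p) powr (1 / p)"
    unfolding Lp_norm_def using assms(2) by (intro powr_mono2) (auto simp: prob_space)
  also have "\<dots> = r" using assms(2,5) by (simp add: powr_powr)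
  finally show ?thesis .
qed

lemma ae_class_in_Lp_space: "f \<in> Lp_fun M p \<Longrightarrow> ae_class M f \<in> Lp_space M p"
  by (simp add: Lp_space_def)

lemma Lp_dist_eq:
  assumes "f \<in> Lp_fun M p" "g \<in> Lp_fun M p"
  shows "Lp_dist M p (ae_class M f) (ae_class M g) = Lp_norm M p (\<lambda>w. f w - g w)"
  using assms by (intro Lp_dist_ae_class Lp_fun_measurable)

text \<open>
Composition with \<open>u\<close> is an isometry of \<open>L\<^sup>p\<close>, so an approximation \<open>h\<close> of \<open>f\<close> turns into an equally good
approximation \<open>h \<circ> u\<close> of \<open>f \<circ> u\<close>, and nearly as good a one of any
function close to \<open>f \<circ> u\<close>.
\<close>

lemma Lp_dist_rearranged:
  assumes M: "prob_space M" and p: "1 \<le> p" and u: "u \<in> mp_isos M"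
    and f: "f \<in> Lp_fun M p" and f': "f' \<in> Lp_fun M p" and h: "h \<in> Lp_fun M p"
    and close: "AE w in M. norm (f (u w) - f' w) \<le> r" and r: "0 \<le> r"
  shows "Lp_dist M p (ae_class M f') (ae_class M (h \<circ> u)) \<le>
    r + Lp_dist M p (ae_class M f) (ae_class M h)"
proof -
  interpret Metric_space "Lp_space M p :: ('a \<Rightarrow> 'b) set set" "Lp_dist M p"
    by (rule Metric_space_Lp[OF p])
  note in_Lp = f' Lp_comp_mp_iso(1)[OF u f] Lp_comp_mp_iso(1)[OF u h]
  have "Lp_dist M p (ae_class M f') (ae_class M (h \<circ> u)) \<le>
      Lp_dist M p (ae_class M f') (ae_class M (f \<circ> u)) +
      Lp_dist M p (ae_class M (f \<circ> u)) (ae_class M (h \<circ> u))"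
    by (intro triangle ae_class_in_Lp_space in_Lp)
  also have "Lp_dist M p (ae_class M f') (ae_class M (f \<circ> u)) \<le> r"
    unfolding Lp_dist_eq[OF in_Lp(1,2)]
    using close r by (intro Lp_norm_le_AE_bound[OF M p] Lp_fun_diff[OF p] in_Lp)
      (auto simp: norm_minus_commute)
  also have "Lp_dist M p (ae_class M (f \<circ> u)) (ae_class M (h \<circ> u)) =
      Lp_dist M p (ae_class M f) (ae_class M h)"
    using Lp_comp_mp_iso(2)[OF u Lp_fun_diff[OF p f h]]
    unfolding Lp_dist_eq[OF in_Lp(2,3)] Lp_dist_eq[OF f h] by (simp add: comp_def)
  finally show ?thesis by (simp add: comp_def)
qed

section \<open>Closures of invariant sets\<close>

lemma closure_of_prod_metric_iff:
  assumes "Metric_space X d" "Metric_space Y d'"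
  shows "(x, y) \<in> prod_topology (Metric_space.mtopology X d) (Metric_space.mtopology Y d') closure_of B
    \<longleftrightarrow> x \<in> X \<and> y \<in> Y \<and> (\<forall>r>0. \<exists>(x', y')\<in>B. x' \<in> X \<and> y' \<in> Y \<and> d x x' < r \<and> d' y y' < r)"
    (is "?L \<longleftrightarrow> ?R")
proof -
  interpret X: Metric_space X d by fact
  interpret Y: Metric_space Y d' by fact
  show ?thesis
  proof
    assume L: ?L
    then have xy: "x \<in> X" "y \<in> Y" by (auto simp: in_closure_of)
    have "\<exists>(x', y')\<in>B. x' \<in> X \<and> y' \<in> Y \<and> d x x' < r \<and> d' y y' < r" if "0 < r" for r
    proof -
      have op: "openin (prod_topology X.mtopology Y.mtopology) (X.mball x r \<times> Y.mball y r)"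
        by (simp add: openin_prod_Times_iff)
      have mem: "(x, y) \<in> X.mball x r \<times> Y.mball y r" using xy that by simp
      from L[unfolded in_closure_of, THEN conjunct2, THEN spec, THEN mp, OF conjI[OF mem op]]
      obtain z where "z \<in> B" "z \<in> X.mball x r \<times> Y.mball y r" by (elim exE conjE)
      then show ?thesis by (intro bexI[of _ z]) (auto simp: X.in_mball Y.in_mball)
    qed
    then show ?R using xy by blast
  next
    assume R: ?R
    show ?L
      unfolding in_closure_of
    proof (intro conjI allI impI)
      show "(x, y) \<in> topspace (prod_topology X.mtopology Y.mtopology)" using R by simp
      fix T assume T: "(x, y) \<in> T \<and> openin (prod_topology X.mtopology Y.mtopology) T"
      then obtain U V where UV: "openin X.mtopology U" "openin Y.mtopology V" "x \<in> U" "y \<in> V" "U \<times> V \<subseteq> T"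
        unfolding openin_prod_topology_alt by blast
      obtain r where r: "r > 0" "X.mball x r \<subseteq> U" using UV unfolding X.openin_mtopology by blast
      obtain s where s: "s > 0" "Y.mball y s \<subseteq> V" using UV unfolding Y.openin_mtopology by blast
      have "0 < min r s" using r s by simp
      with R obtain x' y' where "(x', y') \<in> B" "x' \<in> X" "y' \<in> Y" "d x x' < min r s" "d' y y' < min r s"
        by blast
      moreover from this have "x' \<in> U" "y' \<in> V"
        using r(2) s(2) R by (auto simp: subset_iff X.in_mball Y.in_mball)
      ultimately show "\<exists>z. z \<in> B \<and> z \<in> T" using UV(5) by blast
    qed
  qed
qed

text \<open>
Given a point \<open>(f, g)\<close> of the closure and \<open>(f', g')\<close> of the same law, a pair \<open>(h, k)\<close> of \<open>B\<close> near
\<open>(f, g)\<close> is moved by a rearrangement \<open>u\<close> that brings \<open>(f \<circ> u, g \<circ> u)\<close> uniformly near \<open>(f', g')\<close>.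
The same \<open>u\<close> has to serve both components, which is why the approximation is made for
the pair as a single map.
\<close>

lemma law_invariant_closure:
  fixes B :: "(('a \<Rightarrow> 'x::{banach, second_countable_topology}) set \<times>
             ('a \<Rightarrow> 'y::{banach, second_countable_topology}) set) set"
  assumes M: "prob_space M" "standard_borel M" "nonatomic M" and pq: "1 \<le> p" "1 \<le> q"
    and B: "mp_invariant M p q B"
  shows "law_invariant M p q (prod_topology (Lp_topology M p) (Lp_topology M q) closure_of B)"
  unfolding law_invariant_def
proof (intro ballI impI, elim conjE)
  fix f f' :: "'a \<Rightarrow> 'x" and g g' :: "'a \<Rightarrow> 'y"
  assume f: "f \<in> Lp_fun M p" and g: "g \<in> Lp_fun M q"
    and f': "f' \<in> Lp_fun M p" and g': "g' \<in> Lp_fun M q"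
    and cl: "(ae_class M f, ae_class M g) \<in> prod_topology (Lp_topology M p) (Lp_topology M q) closure_of B"
    and law: "distr M borel (\<lambda>w. (f w, g w)) = distr M borel (\<lambda>w. (f' w, g' w))"
  note [measurable] = f[THEN Lp_fun_measurable] g[THEN Lp_fun_measurable]
    f'[THEN Lp_fun_measurable] g'[THEN Lp_fun_measurable]
  note closure_iff = closure_of_prod_metric_iff[OF Metric_space_Lp[OF pq(1), of M]
      Metric_space_Lp[OF pq(2), of M], folded Lp_topology_def]
  show "(ae_class M f', ae_class M g') \<in> prod_topology (Lp_topology M p) (Lp_topology M q) closure_of B"
    unfolding closure_iff
  proof (intro conjI allI impI)
    fix r :: real assume r: "0 < r"
    then obtain H K where "(H, K) \<in> B" "H \<in> Lp_space M p" "K \<in> Lp_space M q"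
      "Lp_dist M p (ae_class M f) H < r / 2" "Lp_dist M q (ae_class M g) K < r / 2"
      using cl[unfolded closure_iff] by (force dest: spec[of _ "r / 2"])
    then obtain h k where h: "h \<in> Lp_fun M p" and k: "k \<in> Lp_fun M q"
      and hk: "(ae_class M h, ae_class M k) \<in> B"
      and near: "Lp_dist M p (ae_class M f) (ae_class M h) < r / 2"
        "Lp_dist M q (ae_class M g) (ae_class M k) < r / 2"
      unfolding Lp_space_def by blast
    obtain u where u: "u \<in> mp_isos M"
      and close: "AE w in M. dist (f (u w), g (u w)) (f' w, g' w) < r / 2"
      using equal_law_approximation[OF M _ _ law, of "r / 2"] r by auto
    have "AE w in M. norm (f (u w) - f' w) \<le> r / 2"
      using close
      by eventually_elim (metis dist_fst_le dist_norm fst_conv less_imp_le order.trans)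
    moreover have "AE w in M. norm (g (u w) - g' w) \<le> r / 2"
      using close
      by eventually_elim (metis dist_snd_le dist_norm snd_conv less_imp_le order.trans)
    ultimately have "Lp_dist M p (ae_class M f') (ae_class M (h \<circ> u)) < r"
      "Lp_dist M q (ae_class M g') (ae_class M (k \<circ> u)) < r"
      using Lp_dist_rearranged[OF M(1) pq(1) u f f' h, of "r / 2"]
        Lp_dist_rearranged[OF M(1) pq(2) u g g' k, of "r / 2"] near r by auto
    moreover have "(ae_class M (h \<circ> u), ae_class M (k \<circ> u)) \<in> B"
      using B h k hk u unfolding mp_invariant_def by blast
    ultimately show "\<exists>(x', y')\<in>B. x' \<in> Lp_space M p \<and> y' \<in> Lp_space M q \<and>
        Lp_dist M p (ae_class M f') x' < r \<and> Lp_dist M q (ae_class M g') y' < r"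
      using Lp_comp_mp_iso(1)[OF u h] Lp_comp_mp_iso(1)[OF u k]
      by (intro bexI[of _ "(ae_class M (h \<circ> u), ae_class M (k \<circ> u))"])
        (auto simp: ae_class_in_Lp_space)
  qed (use f' g' in \<open>auto simp: ae_class_in_Lp_space\<close>)
qed

lemma law_invariant_imp_mp_invariant:
  fixes C :: "(('a \<Rightarrow> 'x::{banach, second_countable_topology}) set \<times>
             ('a \<Rightarrow> 'y::{banach, second_countable_topology}) set) set"
  assumes "law_invariant M p q C"
  shows "mp_invariant M p q C"
  unfolding mp_invariant_def
proof (intro ballI impI)
  fix f :: "'a \<Rightarrow> 'x" and g :: "'a \<Rightarrow> 'y" and u
  assume f: "f \<in> Lp_fun M p" and g: "g \<in> Lp_fun M q" and u: "u \<in> mp_isos M"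
    and C: "(ae_class M f, ae_class M g) \<in> C"
  note [measurable] = f[THEN Lp_fun_measurable] g[THEN Lp_fun_measurable] mp_isosD(1)[OF u]
  have "distr M borel (\<lambda>w. ((f \<circ> u) w, (g \<circ> u) w)) = distr (distr M M u) borel (\<lambda>w. (f w, g w))"
    by (subst distr_distr) (auto simp: comp_def)
  then have "distr M borel (\<lambda>w. (f w, g w)) = distr M borel (\<lambda>w. ((f \<circ> u) w, (g \<circ> u) w))"
    by (simp add: mp_isosD(2)[OF u])
  then show "(ae_class M (f \<circ> u), ae_class M (g \<circ> u)) \<in> C"
    using assms C f g Lp_comp_mp_iso(1)[OF u f] Lp_comp_mp_iso(1)[OF u g]
    unfolding law_invariant_def by blast
qed

lemma closedin_op_graph:
  assumes D: "closedin X D" and L: "continuous_map (subtopology X D) Y L" and Y: "Hausdorff_space Y"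
  shows "closedin (prod_topology X Y) (op_graph D L)"
proof -
  have "op_graph D L = (\<lambda>x. (x, L x)) ` topspace (subtopology X D)"
    using closedin_subset[OF D] by (auto simp: op_graph_def)
  then have "closedin (subtopology (prod_topology X Y) (D \<times> topspace Y)) (op_graph D L)"
    using continuous_map_imp_closed_graph[OF L Y] by (simp add: prod_topology_subtopology)
  moreover have "closedin (prod_topology X Y) (D \<times> topspace Y)"
    using D by (simp add: closedin_prod_Times_iff)
  ultimately show ?thesis by (rule closedin_trans_full)
qed

theorem proposition4p3:
  fixes M :: "'a measure" and p q :: real
  assumes "prob_space M" and "standard_borel M" and "nonatomic M"
    and "1 \<le> p" and "1 \<le> q"
  shows
    "(\<forall>B :: (('a \<Rightarrow> 'x::{banach, second_countable_topology}) set \<times>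
             ('a \<Rightarrow> 'y::{banach, second_countable_topology}) set) set.
        B \<subseteq> Lp_space M p \<times> Lp_space M q \<and> mp_invariant M p q B \<longrightarrow>
        law_invariant M p q (prod_topology (Lp_topology M p) (Lp_topology M q) closure_of B)) \<and>
     (\<forall>C :: (('a \<Rightarrow> 'x) set \<times> ('a \<Rightarrow> 'y) set) set.
        closedin (prod_topology (Lp_topology M p) (Lp_topology M q)) C \<longrightarrow>
        (law_invariant M p q C \<longleftrightarrow> mp_invariant M p q C)) \<and>
     (\<forall>(D :: ('a \<Rightarrow> 'x) set set) (L :: ('a \<Rightarrow> 'x) set \<Rightarrow> ('a \<Rightarrow> 'y) set).
        closedin (Lp_topology M p) D \<and>
        continuous_map (subtopology (Lp_topology M p) D) (Lp_topology M q) L \<and>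
        mp_invariant M p q (op_graph D L) \<longrightarrow>
        law_invariant M p q (op_graph D L))"
proof -
  note closure = law_invariant_closure[OF assms]
  have closed: "law_invariant M p q C \<longleftrightarrow> mp_invariant M p q C"
    if "closedin (prod_topology (Lp_topology M p) (Lp_topology M q)) C"
    for C :: "(('a \<Rightarrow> 'x) set \<times> ('a \<Rightarrow> 'y) set) set"
    using closure[of C] law_invariant_imp_mp_invariant[of M p q C] closure_of_closedin[OF that] by auto
  have "Hausdorff_space (Lp_topology M q :: ('a \<Rightarrow> 'y) set topology)"
    unfolding Lp_topology_def
    by (rule Metric_space.Hausdorff_space_mtopology[OF Metric_space_Lp[OF assms(5)]])
  then show ?thesis
    using closure closed closedin_op_graph by blast
qed

end
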